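(* Let Assumption A (see context) hold, let $\mu_n$, $\mu$ and $M_0$ be as defined in the context, let $y\in M_0$ and let the discontinuities of $x\mapsto\rho(x,y)$ belong to a $\mu_X$-zero measurable set. If the functions $x\mapsto\langle x,\alpha\rangle^k\rho(x,y)$ belong to $L^1(\mu_X)$ and satisfy $$\lim_{C\to\infty}\sup_n\int_{\{|\langle\cdot,\alpha\rangle|^k\rho(\cdot,y)>C\}}|\langle x,\alpha\rangle|^k\rho(x,y)\,d\mu_{X_n}(x)=0$$ for $k=0,1$ and $\alpha\in F'$, then the approximated weak conditional mean estimates $\mu_n(\langle\cdot,\alpha\rangle,y)$ converge to the weak conditional mean estimate $\mu(\langle\cdot,\alpha\rangle,y)$ whenever the approximated prior distributions $\mu_{X_n}$ converge weakly to the prior distribution $\mu_X$.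
   Context: A Souslin space is a Hausdorff topological space that is the image of a complete separable metric space under a continuous mapping. $F'$ is the topological dual of $F$. For a random variable $Z$, $\mu_Z=P\circ Z^{-1}$; for $x\in F$, $\mu_{\varepsilon+L(x)}$ is the image measure of $\omega\mapsto\varepsilon(\omega)+L(x)$. Borel measures and their Lebesgue completions are denoted by the same symbol. Assumption A: (1) $F$ and $G$ are locally convex Souslin topological vector spaces with Borel $\sigma$-algebras $\mathcal F$ and $\mathcal G$. (2) $(\Omega,\Sigma,P)$ is a complete probability space, $X$ and $X_n$ ($n\in\mathbf N$) are $F$-valued random variables on $\Omega$ and $\varepsilon$ is a $G$-valued random variable on $\Omega$; $X$ and $\varepsilon$ are independent, and $X_n$ and $\varepsilon$ are independent for each $n$. (3) $L:F\to G$ is continuous; $Y=L(X)+\varepsilon$ and $Y_n=L(X_n)+\varepsilon$. (4) $\mu_{\varepsilon+L(x)}$ is absolutely continuous with respect to some $\sigma$-finite measure $\nu$ on $(G,\mathcal G)$ for any $x\in F$, and its density $\rho(x,y):=\frac{d\mu_{\varepsilon+L(x)}}{d\nu}(y)$ is a $\mu_Z\times\nu$-measurable function on $F\times G$ for $Z=X$ and $Z=X_n$, $n\in\mathbf N$. Definitions: $M_0=\{y\in G:0<\int\rho(x,y)\,d\mu_Z(x)<\infty\text{ for }Z=X\text{ and }Z=X_n,\ n\in\mathbf N\}$, and for $U\in\mathcal F$, $y\in M_0$, $$\mu_n(U,y)=\frac{\int 1_U(x)\rho(x,y)\,d\mu_{X_n}(x)}{\int\rho(x,y)\,d\mu_{X_n}(x)},\qquad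 \mu(U,y)=\frac{\int 1_U(x)\rho(x,y)\,d\mu_X(x)}{\int\rho(x,y)\,d\mu_X(x)}.$$ For a function $f$ on $F$, $\mu_n(f,y)=\int f(x)\,\mu_n(dx,y)$ and $\mu(f,y)=\int f(x)\,\mu(dx,y)$. Measures $m_n$ on $F$ converge weakly to $m$ if $\int f\,dm_n\to\int f\,dm$ for all bounded continuous functions $f$ on $F$. *)

theory Defs
  imports "HOL-Probability.Probability"
begin

class topological_real_vector = real_vector + topological_ab_group_add +
  assumes tendsto_scaleR_Pair_nhds:
    "LIM p (nhds (a::real) \<times>\<^sub>F nhds x). fst p *\<^sub>R snd p :> nhds (a *\<^sub>R x)"

class locally_convex_space = topological_real_vector +
  assumes convex_nhds_base_0_unfolded:
    "open U \<Longrightarrow> 0 \<in> U \<Longrightarrow>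
      \<exists>V. open V \<and> 0 \<in> V \<and> V \<subseteq> U \<and>
        (\<forall>x\<in>V. \<forall>z\<in>V. \<forall>u\<ge>0. \<forall>v\<ge>0. u + v = 1 \<longrightarrow> u *\<^sub>R x + v *\<^sub>R z \<in> V)"

(* The sort constraint of the constant convex keeps it out of the class specification. *)
lemma convex_nhds_base_0:
  fixes U :: "'a::locally_convex_space set"
  assumes "open U" "0 \<in> U"
  shows "\<exists>V. open V \<and> convex V \<and> 0 \<in> V \<and> V \<subseteq> U"
  using convex_nhds_base_0_unfolded[OF assms] unfolding convex_def by blast

(* HOL cannot quantify over types inside a formula, so the carrier of the complete separable
   metric space is taken to be a set of real numbers.  This loses no generality: a separable
   metric space has at most continuum many points, hence is isometric to one carried by a
   subset of the reals (with an arbitrary metric d, unrelated to the usual one). *)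
class souslin_space = t2_space +
  assumes souslin:
    "\<exists>(S :: real set) d f. Metric_space S d \<and> Metric_space.mcomplete S d \<and>
       separable_space (Metric_space.mtopology S d) \<and>
       continuous_map (Metric_space.mtopology S d) euclidean f \<and> f ` S = UNIV"

class locally_convex_souslin_space = locally_convex_space + souslin_space

definition topological_dual :: "('a::topological_real_vector \<Rightarrow> real) set" where
  "topological_dual = {\<alpha>. linear \<alpha> \<and> continuous_on UNIV \<alpha>}"

definition weakly_converges :: "(nat \<Rightarrow> 'a::topological_space measure) \<Rightarrow> 'a measure \<Rightarrow> bool" where
  "weakly_converges m m' \<longleftrightarrow>
     (\<forall>f :: 'a \<Rightarrow> real. continuous_on UNIV f \<and> bounded (range f) \<longrightarrow>
        (\<lambda>n. integral\<^sup>L (m n) f) \<longlonglongrightarrow> integral\<^sup>L m' f)"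

(* The library's indep_var requires both random variables to have the same value type. *)
definition (in prob_space) indep_borel_rv ::
  "('a \<Rightarrow> 'b::topological_space) \<Rightarrow> ('a \<Rightarrow> 'c::topological_space) \<Rightarrow> bool" where
  "indep_borel_rv X Y \<longleftrightarrow> X \<in> borel_measurable M \<and> Y \<in> borel_measurable M \<and>
     indep_set (sets (vimage_algebra (space M) X borel)) (sets (vimage_algebra (space M) Y borel))"

(* Borel measures are identified with their completions, so a density need only be measurable
   for the completion of nu.  The Borel measurable case is included: there the integrals with
   respect to nu and to its completion agree. *)
definition has_density :: "'a measure \<Rightarrow> 'a measure \<Rightarrow> ('a \<Rightarrow> real) \<Rightarrow> bool" where
  "has_density m \<nu> f \<longleftrightarrow> f \<in> borel_measurable (completion \<nu>) \<and> (\<forall>y. 0 \<le> f y) \<and>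
     (\<forall>B\<in>sets m. emeasure m B = (\<integral>\<^sup>+y. ennreal (f y) * indicator B y \<partial>completion \<nu>))"

locale bayes_model = prob_space P + complete_measure P
  for P :: "'w measure" +
  fixes X :: "'w \<Rightarrow> 'f::locally_convex_souslin_space"
    and Xn :: "nat \<Rightarrow> 'w \<Rightarrow> 'f"
    and \<epsilon> :: "'w \<Rightarrow> 'g::locally_convex_souslin_space"
    and L :: "'f \<Rightarrow> 'g"
    and Y :: "'w \<Rightarrow> 'g"
    and Yn :: "nat \<Rightarrow> 'w \<Rightarrow> 'g"
    and \<nu> :: "'g measure"
    and \<rho> :: "'f \<Rightarrow> 'g \<Rightarrow> real"
  assumes X_measurable: "X \<in> borel_measurable P"
    and Xn_measurable: "\<And>n. Xn n \<in> borel_measurable P"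
    and noise_measurable: "\<epsilon> \<in> borel_measurable P"
    and indep_X: "indep_borel_rv X \<epsilon>"
    and indep_Xn: "\<And>n. indep_borel_rv (Xn n) \<epsilon>"
    and L_continuous: "continuous_on UNIV L"
    and Y_eq: "Y = (\<lambda>\<omega>. L (X \<omega>) + \<epsilon> \<omega>)"
    and Yn_eq: "\<And>n. Yn n = (\<lambda>\<omega>. L (Xn n \<omega>) + \<epsilon> \<omega>)"
    and sigma_finite_\<nu>: "sigma_finite_measure \<nu>"
    and sets_\<nu>: "sets \<nu> = sets borel"
    and abs_cont: "\<And>x. absolutely_continuous \<nu> (distr P borel (\<lambda>\<omega>. \<epsilon> \<omega> + L x))"
    and density_\<rho>: "\<And>x. has_density (distr P borel (\<lambda>\<omega>. \<epsilon> \<omega> + L x)) \<nu> (\<rho> x)"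
    and \<rho>_measurable: "\<And>Z. Z \<in> insert X (range Xn) \<Longrightarrow>
          (\<lambda>(x, y). \<rho> x y) \<in> borel_measurable (completion (distr P borel Z \<Otimes>\<^sub>M \<nu>))"

(* Sections of a function that is measurable for the completed product measure are measurable
   only for almost every y.  The measurability that the integral in the definition of this set
   presupposes is therefore stated explicitly. *)
definition M0 :: "'w measure \<Rightarrow> ('w \<Rightarrow> 'f::topological_space) \<Rightarrow> (nat \<Rightarrow> 'w \<Rightarrow> 'f)
    \<Rightarrow> ('f \<Rightarrow> 'g \<Rightarrow> real) \<Rightarrow> 'g set" where
  "M0 P X Xn \<rho> = {y. \<forall>Z \<in> insert X (range Xn).
     (\<lambda>x. \<rho> x y) \<in> borel_measurable (completion (distr P borel Z)) \<and>
     0 < (\<integral>\<^sup>+x. ennreal (\<rho> x y) \<partial>completion (distr P borel Z)) \<and>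
     (\<integral>\<^sup>+x. ennreal (\<rho> x y) \<partial>completion (distr P borel Z)) < \<infinity>}"

definition posterior :: "'f measure \<Rightarrow> ('f \<Rightarrow> 'g \<Rightarrow> real) \<Rightarrow> 'g \<Rightarrow> 'f measure" where
  "posterior m \<rho> y = measure_of (space m) (sets m)
     (\<lambda>U. (\<integral>\<^sup>+x. indicator U x * ennreal (\<rho> x y) \<partial>completion m) /
           (\<integral>\<^sup>+x. ennreal (\<rho> x y) \<partial>completion m))"

lemma emeasure_posterior:
  assumes "(\<lambda>x. \<rho> x y) \<in> borel_measurable (completion m)" and U: "U \<in> sets m"
  shows "emeasure (posterior m \<rho> y) U =
    (\<integral>\<^sup>+x. indicator U x * ennreal (\<rho> x y) \<partial>completion m) /
    (\<integral>\<^sup>+x. ennreal (\<rho> x y) \<partial>completion m)"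
proof (rule emeasure_measure_of[OF posterior_def])
  let ?I = "\<lambda>U. \<integral>\<^sup>+x. indicator U x * ennreal (\<rho> x y) \<partial>completion m"
  let ?c = "\<integral>\<^sup>+x. ennreal (\<rho> x y) \<partial>completion m"
  show "sets m \<subseteq> Pow (space m)" by (rule sets.space_closed)
  show "U \<in> sets (posterior m \<rho> y)" using U by (simp add: posterior_def)
  show "positive (sets (posterior m \<rho> y)) (\<lambda>U. ?I U / ?c)"
    by (simp add: positive_def)
  show "countably_additive (sets (posterior m \<rho> y)) (\<lambda>U. ?I U / ?c)"
  proof (rule countably_additiveI)
    fix A :: "nat \<Rightarrow> 'a set"
    assume A: "range A \<subseteq> sets (posterior m \<rho> y)" "disjoint_family A"
    then have [measurable]: "A i \<in> sets (completion m)" for i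
      by (auto simp: posterior_def)
    note [measurable] = assms(1)
    have "(\<Sum>i. ?I (A i) / ?c) = (\<Sum>i. ?I (A i)) / ?c"
      by (simp add: divide_ennreal_def)
    also have "(\<Sum>i. ?I (A i)) = (\<integral>\<^sup>+x. (\<Sum>i. indicator (A i) x * ennreal (\<rho> x y)) \<partial>completion m)"
      by (rule nn_integral_suminf[symmetric]) measurable
    also have "\<dots> = ?I (\<Union>i. A i)"
      by (intro nn_integral_cong) (simp add: suminf_indicator[OF A(2)])
    finally show "(\<Sum>i. ?I (A i) / ?c) = ?I (\<Union>i. A i) / ?c" .
  qed
qed

end

theory Submission
  imports Defs
begin

text \<open>
  A Souslin space is hereditarily Lindelof, and a topological vector space is regular. So the prior
  space is normal and its open sets are countable unions of closed sets, and the indicator of an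
  open set is a pointwise limit of continuous functions below it. Weak convergence therefore gives
  the portmanteau inequalities without a metric. Hence the laws of a real function with
  \<open>\<mu>\<^sub>X\<close>-null discontinuities converge weakly on the real line. Truncation and
  uniform integrability upgrade this to convergence of the integrals of \<open>\<langle>\<cdot>,\<alpha>\<rangle>\<^sup>k \<rho>(\<cdot>,y)\<close> for
  \<open>k = 0, 1\<close>, whose quotient is the conditional mean.
\<close>

section \<open>Separability and the Lindelof property of Souslin spaces\<close>

text \<open>The base consists of the balls of radius 1/(k+1) about the points of a countable dense
  set. Inside the ball of radius r about x, take 1/(k+1) < r/2 and a dense point c closer to x than
  that; by the triangle inequality the ball about c contains x and stays inside.\<close>

lemma (in Metric_space) separable_imp_second_countable:
  assumes "separable_space mtopology"
  shows "second_countable mtopology"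
proof -
  obtain C where C: "countable C" "C \<subseteq> M" "mtopology closure_of C = M"
    using assms by (auto simp: separable_space_def)
  let ?B = "(\<lambda>(c, k). mball c (inverse (real (Suc k)))) ` (C \<times> UNIV)"
  have base: "\<exists>V\<in>?B. x \<in> V \<and> V \<subseteq> U" if "openin mtopology U" "x \<in> U" for U x
  proof -
    obtain r where r: "r > 0" "mball x r \<subseteq> U" and x: "x \<in> M"
      using \<open>openin mtopology U\<close> \<open>x \<in> U\<close> unfolding openin_mtopology by blast
    obtain k where k: "inverse (real (Suc k)) < r / 2"
      using reals_Archimedean[of "r / 2"] r by auto
    have "x \<in> mtopology closure_of C" using x C by simp
    then have "\<forall>r>0. \<exists>c\<in>C. c \<in> mball x r" by (simp add: metric_closure_of)
    moreover have "0 < inverse (real (Suc k))" by simp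
    ultimately obtain c where c: "c \<in> C" "c \<in> mball x (inverse (real (Suc k)))" by blast
    have "mball c (inverse (real (Suc k))) \<subseteq> mball x r"
    proof
      fix z assume "z \<in> mball c (inverse (real (Suc k)))"
      moreover from this c have "d x z \<le> d x c + d c z" by (intro triangle) auto
      ultimately show "z \<in> mball x r" using c k x by auto
    qed
    moreover have "x \<in> mball c (inverse (real (Suc k)))"
      using c by (simp add: commute)
    ultimately show ?thesis using c r by (intro bexI[of _ "mball c (inverse (real (Suc k)))"]) auto
  qed
  show ?thesis
    unfolding second_countable_def
  proof (intro exI[of _ ?B] conjI ballI allI impI)
    show "countable ?B" using C(1) by simp
    show "openin mtopology V" if "V \<in> ?B" for V using that by auto
    show "\<exists>V\<in>?B. x \<in> V \<and> V \<subseteq> U" if "openin mtopology U \<and> x \<in> U" for U x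
      using that base by blast
  qed
qed

text \<open>Second countability passes to every subspace of the metric space, in particular to the
  preimage of \<open>U\<close>, and the Lindelof property passes to its continuous image
  \<open>U\<close>. Arbitrary subsets are treated because the Lindelof property alone is not
  inherited by open subsets.\<close>

lemma souslin_hereditarily_Lindelof:
  fixes U :: "'a::souslin_space set"
  shows "Lindelof_space (top_of_set U)"
proof -
  obtain S :: "real set" and d and f :: "real \<Rightarrow> 'a" where
    S: "Metric_space S d" "separable_space (Metric_space.mtopology S d)"
    and f: "continuous_map (Metric_space.mtopology S d) euclidean f" "f ` S = UNIV"
    using souslin by blast
  interpret Metric_space S d by fact
  let ?T = "subtopology mtopology {s \<in> S. f s \<in> U}"
  have "second_countable ?T"
    using S separable_imp_second_countable by (simp add: second_countable_subtopology)
  then have "Lindelof_space ?T" by (rule second_countable_imp_Lindelof_space)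
  moreover have "continuous_map ?T (top_of_set U) f"
    using f by (auto simp: continuous_map_in_subtopology intro: continuous_map_from_subtopology)
  moreover have "f ` topspace ?T = topspace (top_of_set U)"
    using f(2) by auto
  ultimately show ?thesis by (rule Lindelof_space_continuous_map_image)
qed

section \<open>Regularity of topological abelian groups\<close>

text \<open>Continuity of subtraction gives neighbourhoods A, B of 0 with A - B + x inside U. Take V
  = x + A: if z is in its closure, then z + B meets V, so x + a = z + b for some a in A and b in B,
  and z = a - b + x lies in U.\<close>

lemma topological_group_closed_neighbourhood:
  fixes x :: "'a::topological_ab_group_add"
  assumes "open U" "x \<in> U"
  obtains V where "open V" "x \<in> V" "closure V \<subseteq> U"
proof -
  have "((\<lambda>p. fst p - snd p + x) \<longlongrightarrow> 0 - 0 + x) (nhds 0 \<times>\<^sub>F nhds (0::'a))"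
    by (intro tendsto_intros filterlim_fst filterlim_snd)
  then have *: "\<forall>\<^sub>F p in nhds 0 \<times>\<^sub>F nhds (0::'a). fst p - snd p + x \<in> U"
    using assms by (auto dest: topological_tendstoD)
  obtain A B where AB: "open A" "0 \<in> A" "open B" "0 \<in> B"
    "\<And>a b. a \<in> A \<Longrightarrow> b \<in> B \<Longrightarrow> a - b + x \<in> U"
  proof -
    obtain Q R where QR: "eventually Q (nhds (0::'a))" "eventually R (nhds (0::'a))"
      "\<And>a b. Q a \<Longrightarrow> R b \<Longrightarrow> a - b + x \<in> U"
      using * unfolding eventually_prod_filter by auto
    obtain A B where "open A" "0 \<in> A" "\<And>a. a \<in> A \<Longrightarrow> Q a" "open B" "0 \<in> B" "\<And>b. b \<in> B \<Longrightarrow> R b"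
      using QR(1,2) unfolding eventually_nhds by blast
    then show ?thesis by (intro that[of A B]) (simp_all add: QR(3))
  qed
  have open_shift: "open ((\<lambda>z. z - c) -` W)" if "open W" for W and c :: 'a
  proof -
    have "continuous_on UNIV (\<lambda>z::'a. z - c)"
      unfolding continuous_on_def by (auto intro!: tendsto_intros)
    then show ?thesis using that by (simp add: open_vimage)
  qed
  define V where "V = (\<lambda>z. z - x) -` A"
  have "closure V \<subseteq> U"
  proof
    fix z assume z: "z \<in> closure V"
    \<comment> \<open>This preimage is the translate z + B, a neighbourhood of z.\<close>
    have "open ((\<lambda>v. v - z) -` B)" "z \<in> (\<lambda>v. v - z) -` B"
      using AB open_shift by auto
    then have "V \<inter> (\<lambda>v. v - z) -` B \<noteq> {}"
      using z unfolding closure_iff_nhds_not_empty by blast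
    then obtain v where v: "v \<in> V" "v - z \<in> B" by auto
    then have "(v - x) - (v - z) + x \<in> U" by (intro AB(5)) (simp_all add: V_def)
    then show "z \<in> U" by simp
  qed
  moreover have "open V" "x \<in> V" using AB open_shift by (auto simp: V_def)
  ultimately show ?thesis using that by blast
qed

lemma regular_space_topological_group:
  "regular_space (euclidean :: 'a::topological_ab_group_add topology)"
  unfolding regular_space_def
proof (intro allI impI)
  fix C and a :: 'a
  assume "closedin euclidean C \<and> a \<in> topspace euclidean - C"
  then have "open (- C)" "a \<in> - C" by auto
  then obtain V where "open V" "a \<in> V" "closure V \<subseteq> - C"
    by (rule topological_group_closed_neighbourhood)
  then show "\<exists>U V. openin euclidean U \<and> openin euclidean V \<and> a \<in> U \<and> C \<subseteq> V \<and> disjnt U V"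
    using closure_subset by (intro exI[of _ V] exI[of _ "- closure V"]) (auto simp: disjnt_def)
qed

section \<open>Approximation of open sets from inside\<close>

text \<open>By regularity, \<open>U\<close> is covered by open sets whose closures stay in
  \<open>U\<close>; the Lindelof property of the subspace \<open>U\<close> leaves countably many of
  them, and their closures still fill exactly \<open>U\<close>.\<close>

lemma open_eq_countable_Union_closed:
  fixes U :: "'a::locally_convex_souslin_space set"
  assumes "open U"
  obtains K :: "nat \<Rightarrow> 'a set" where "\<And>i. closed (K i)" "(\<Union>i. K i) = U"
\<comment> \<open>The enumeration \<open>from_nat_into\<close> used below requires a nonempty
  countable family, which a nonempty \<open>U\<close> guarantees.\<close>
proof (cases "U = {}")
  case True
  then show ?thesis using that[of "\<lambda>_. {}"] by simp
next
  case False
  let ?\<U> = "{V. open V \<and> V \<subseteq> U \<and> closure V \<subseteq> U}"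
  have "\<Union>?\<U> = topspace (top_of_set U)"
  proof -
    have "\<exists>V\<in>?\<U>. x \<in> V" if "x \<in> U" for x
    proof -
      obtain V where "open V" "x \<in> V" "closure V \<subseteq> U"
        by (rule topological_group_closed_neighbourhood[OF assms \<open>x \<in> U\<close>])
      then show ?thesis using closure_subset by blast
    qed
    then show ?thesis by auto
  qed
  moreover have "openin (top_of_set U) V" if "V \<in> ?\<U>" for V
    using that by (auto simp: openin_open)
  ultimately obtain \<V> where \<V>: "countable \<V>" "\<V> \<subseteq> ?\<U>" "\<Union>\<V> = U"
    using Lindelof_spaceD[OF souslin_hereditarily_Lindelof[of U], of ?\<U>] by auto
  then have "\<V> \<noteq> {}" using False by auto
  have "(\<Union>i. closure (from_nat_into \<V> i)) = U"
  proof -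
    have "(\<Union>i. closure (from_nat_into \<V> i)) = (\<Union>V\<in>\<V>. closure V)"
      using range_from_nat_into[OF \<open>\<V> \<noteq> {}\<close> \<V>(1)] by (metis image_image)
    also have "\<dots> = U" using \<V> closure_subset by blast
    finally show ?thesis .
  qed
  then show ?thesis using that[of "\<lambda>i. closure (from_nat_into \<V> i)"] by simp
qed

text \<open>A regular Lindelof space is normal, so Urysohn functions exist. The i-th one vanishes
  off \<open>U\<close> and is 1 on the first closed pieces of \<open>U\<close>, hence at each point
  the sequence is eventually equal to the indicator.\<close>

lemma open_indicator_continuous_limit:
  fixes U :: "'a::locally_convex_souslin_space set"
  assumes "open U"
  obtains \<phi> :: "nat \<Rightarrow> 'a \<Rightarrow> real" where
    "\<And>i. continuous_on UNIV (\<phi> i)" "\<And>i x. 0 \<le> \<phi> i x" "\<And>i x. \<phi> i x \<le> indicator U x"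
    "\<And>x. (\<lambda>i. \<phi> i x) \<longlonglongrightarrow> indicator U x"
proof -
  have normal: "normal_space (euclidean :: 'a topology)"
    using souslin_hereditarily_Lindelof[of "UNIV :: 'a set"]
    by (intro regular_Lindelof_imp_normal_space regular_space_topological_group) simp
  obtain K where K: "\<And>i::nat. closed (K i)" "(\<Union>i. K i) = U"
    using open_eq_countable_Union_closed[OF assms] by blast
  \<comment> \<open>The sets \<open>K j\<close> need not be nested; the union over j \<le> i is
    still closed, and it keeps the value 1 at a point of \<open>K j\<close> for every later
    index.\<close>
  have "\<exists>f :: 'a \<Rightarrow> real. continuous_on UNIV f \<and> range f \<subseteq> {0..1} \<and> f ` (- U) \<subseteq> {0} \<and>
      f ` (\<Union>j\<le>i. K j) \<subseteq> {1}" for i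
  proof -
    have "closedin euclidean (- U)" "closedin euclidean (\<Union>j\<le>i. K j)"
      using assms K by (auto intro!: closed_UN)
    moreover have "disjnt (- U) (\<Union>j\<le>i. K j)"
      using K(2) by (auto simp: disjnt_def)
    ultimately obtain f :: "'a \<Rightarrow> real" where
      "continuous_map euclidean (top_of_set {0..1}) f" "f ` (- U) \<subseteq> {0}" "f ` (\<Union>j\<le>i. K j) \<subseteq> {1}"
      using Urysohn_lemma[OF normal, of "- U" "\<Union>j\<le>i. K j" 0 1] by auto
    then show ?thesis by (intro exI[of _ f]) (auto simp: continuous_map_in_subtopology)
  qed
  then obtain \<phi> :: "nat \<Rightarrow> 'a \<Rightarrow> real" where
    cont: "\<And>i. continuous_on UNIV (\<phi> i)" and range: "\<And>i. range (\<phi> i) \<subseteq> {0..1}"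
    and zero: "\<And>i. \<phi> i ` (- U) \<subseteq> {0}" and one: "\<And>i. \<phi> i ` (\<Union>j\<le>i. K j) \<subseteq> {1}"
    by metis
  have bounds: "0 \<le> \<phi> i x" "\<phi> i x \<le> 1" for i x
    using subsetD[OF range rangeI[of "\<phi> i" x]] by auto
  have outside: "\<phi> i x = 0" if "x \<notin> U" for i x
    using zero[of i] that by auto
  show ?thesis
  proof (rule that[of \<phi>])
    show "\<phi> i x \<le> indicator U x" for i x
      using bounds outside by (auto simp: indicator_def)
    show "(\<lambda>i. \<phi> i x) \<longlonglongrightarrow> indicator U x" for x
    proof (cases "x \<in> U")
      case True
      then obtain j where "x \<in> K j" using K(2) by blast
      then have "\<phi> i x = 1" if "j \<le> i" for i using one[of i] that by blast
      then have "\<forall>\<^sub>F i in sequentially. \<phi> i x = indicator U x"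
        using True by (auto intro!: eventually_sequentiallyI[of j])
      then show ?thesis by (rule tendsto_eventually)
    qed (simp add: outside)
  qed (use cont bounds in auto)
qed

section \<open>Portmanteau inequalities\<close>

context
  fixes m :: "nat \<Rightarrow> 'a::locally_convex_souslin_space measure" and m' :: "'a measure"
  assumes prob: "\<And>n. prob_space (m n)" "prob_space m'"
    and borel: "\<And>n. sets (m n) = sets borel" "sets m' = sets borel"
    and weak: "weakly_converges m m'"
begin

text \<open>The liminf inequality for open sets. Dominated convergence supplies one continuous
  function below the indicator whose limit integral exceeds \<open>measure m' U - e\<close>; weak
  convergence transfers this bound to its integrals under \<open>m n\<close>, which are at most
  \<open>measure (m n) U\<close>.\<close>

lemma weakly_converges_open_lower:
  assumes "open U" "e > 0"
  shows "\<forall>\<^sub>F n in sequentially. measure (m n) U > measure m' U - e"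
proof -
  interpret n: prob_space "m n" for n by (fact prob(1))
  interpret l: prob_space m' by (fact prob(2))
  note [measurable_cong] = borel
  have U[measurable]: "U \<in> sets borel" using assms by simp
  obtain \<phi> :: "nat \<Rightarrow> 'a \<Rightarrow> real" where \<phi>:
    "\<And>i. continuous_on UNIV (\<phi> i)" "\<And>i x. 0 \<le> \<phi> i x" "\<And>i x. \<phi> i x \<le> indicator U x"
    "\<And>x. (\<lambda>i. \<phi> i x) \<longlonglongrightarrow> indicator U x"
    using open_indicator_continuous_limit[OF assms(1)] by blast
  have [measurable]: "\<phi> i \<in> borel_measurable borel" for i
    using \<phi>(1) by (rule borel_measurable_continuous_onI)
  have bounded: "\<bar>\<phi> i x\<bar> \<le> 1" for i x
    using \<phi>(2,3)[of i x] by (cases "x \<in> U") auto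
  have "(\<lambda>i. integral\<^sup>L m' (\<phi> i)) \<longlonglongrightarrow> integral\<^sup>L m' (indicator U)"
    by (rule integral_dominated_convergence[where w="\<lambda>_. 1"]) (use \<phi> bounded in auto)
  then have "\<forall>\<^sub>F i in sequentially. integral\<^sup>L m' (\<phi> i) > measure m' U - e"
    using assms by (intro order_tendstoD(1)) auto
  then obtain i where i: "integral\<^sup>L m' (\<phi> i) > measure m' U - e"
    by (auto simp: eventually_sequentially)
  have "(\<lambda>n. integral\<^sup>L (m n) (\<phi> i)) \<longlonglongrightarrow> integral\<^sup>L m' (\<phi> i)"
  proof -
    have "bounded (range (\<phi> i))" using bounded by (auto simp: bounded_iff)
    then show ?thesis using weak \<phi>(1) unfolding weakly_converges_def by blast
  qed
  then have "\<forall>\<^sub>F n in sequentially. integral\<^sup>L (m n) (\<phi> i) > measure m' U - e"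
    using i by (intro order_tendstoD(1))
  then show ?thesis
  proof eventually_elim
    case (elim n)
    have "integral\<^sup>L (m n) (\<phi> i) \<le> integral\<^sup>L (m n) (indicator U)"
      by (intro integral_mono \<phi> n.integrable_const_bound[where B=1]) (use bounded in auto)
    then show ?case using elim borel by simp
  qed
qed

text \<open>Complement of the open case; the inequality reverses because all total masses are
  1.\<close>

lemma weakly_converges_closed_upper:
  assumes "closed C" "e > 0"
  shows "\<forall>\<^sub>F n in sequentially. measure (m n) C < measure m' C + e"
proof -
  interpret n: prob_space "m n" for n by (fact prob(1))
  interpret l: prob_space m' by (fact prob(2))
  have sp: "space (m n) = UNIV" "space m' = UNIV" for n
    using borel[THEN sets_eq_imp_space_eq] by auto
  have C: "C \<in> sets (m n)" "C \<in> sets m'" for n using assms borel by auto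
  have "measure (m n) (- C) = 1 - measure (m n) C" "measure m' (- C) = 1 - measure m' C" for n
    using n.prob_compl[OF C(1)] l.prob_compl[OF C(2)] by (auto simp: sp Compl_eq_Diff_UNIV)
  then show ?thesis
    using weakly_converges_open_lower[of "- C" e] assms
    by (simp add: open_Compl) (auto elim: eventually_mono)
qed

text \<open>\<open>B\<close> is squeezed between its interior and its closure, which are Borel and
  have equal limit mass since the frontier is null. Measurability of \<open>B\<close> is asked only
  for the completions because \<open>B\<close> will be the preimage of a Borel set under a function
  measurable in that sense.\<close>

lemma weakly_converges_continuity_set:
  assumes B: "\<And>n. B \<in> sets (completion (m n))" "B \<in> sets (completion m')"
    and frontier: "frontier B \<in> null_sets m'"
  shows "(\<lambda>n. measure (completion (m n)) B) \<longlonglongrightarrow> measure (completion m') B"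
proof (rule order_tendstoI)
  interpret n: prob_space "completion (m n)" for n
    using prob by (simp add: prob_space.prob_space_completion)
  interpret l: prob_space "completion m'"
    using prob by (simp add: prob_space.prob_space_completion)
  have sets: "S \<in> sets (m n)" "S \<in> sets m'" "S \<in> sets (completion (m n))" "S \<in> sets (completion m')"
    if "S \<in> sets borel" for n S using that borel by auto
  note S = sets[of "interior B"] sets[of "closure B"]
  have "closure B = interior B \<union> frontier B"
    using interior_subset closure_subset by (auto simp: frontier_def)
  then have eq: "measure m' (closure B) = measure m' (interior B)"
    using frontier S by (simp add: measure_Un_null_set)
  have le: "measure m' (interior B) \<le> measure (completion m') B"
      "measure (completion m') B \<le> measure m' (closure B)"
      "measure (m n) (interior B) \<le> measure (completion (m n)) B"
      "measure (completion (m n)) B \<le> measure (m n) (closure B)" for n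
    using l.finite_measure_mono[OF interior_subset B(2)] l.finite_measure_mono[OF closure_subset[of B]]
      n.finite_measure_mono[OF interior_subset B(1)] n.finite_measure_mono[OF closure_subset[of B]] S
    by auto
  fix a
  show "\<forall>\<^sub>F n in sequentially. a < measure (completion (m n)) B"
    if "a < measure (completion m') B"
  proof -
    \<comment> \<open>The tolerance \<open>measure m' (interior B) - a\<close> makes the lower bound
      equal to a. It is positive because the interior has the same limit mass as the closure, which
      is at least that of \<open>B\<close>.\<close>
    have "\<forall>\<^sub>F n in sequentially. a < measure (m n) (interior B)"
      using weakly_converges_open_lower[of "interior B" "measure m' (interior B) - a"] that le eq
      by simp
    then show ?thesis by eventually_elim (rule order.strict_trans2[OF _ le(3)])
  qed
  show "\<forall>\<^sub>F n in sequentially. measure (completion (m n)) B < a"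
    if "measure (completion m') B < a"
  proof -
    have "\<forall>\<^sub>F n in sequentially. measure (m n) (closure B) < a"
      using weakly_converges_closed_upper[of "closure B" "a - measure m' (closure B)"] that le eq
      by simp
    then show ?thesis by eventually_elim (rule order.strict_trans1[OF le(4)])
  qed
qed

end

section \<open>Almost everywhere continuous functions: mapping theorem and uniform
  integrability\<close>

text \<open>Near a continuity point x with h x off the frontier of A, the values of h stay inside A
  or stay outside A, so x is interior to the preimage or to its complement. This turns continuity
  sets on the line into continuity sets in the space.\<close>

lemma frontier_vimage_subset:
  fixes h :: "'a::t2_space \<Rightarrow> 'b::t2_space"
  shows "frontier (h -` A) \<subseteq> h -` frontier A \<union> {x. \<not> isCont h x}"
proof
  fix x assume x: "x \<in> frontier (h -` A)"
  show "x \<in> h -` frontier A \<union> {x. \<not> isCont h x}"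
  proof (rule ccontr)
    assume "x \<notin> h -` frontier A \<union> {x. \<not> isCont h x}"
    then have cont: "isCont h x" and "h x \<in> interior A \<or> h x \<in> - closure A"
      by (auto simp: frontier_def)
    then obtain W where W: "open W" "h x \<in> W" "W \<subseteq> A \<or> W \<inter> A = {}"
    proof (elim disjE)
      assume "h x \<in> interior A"
      then show ?thesis using that[of "interior A"] interior_subset by auto
    next
      assume "h x \<in> - closure A"
      then show ?thesis using that[of "- closure A"] closure_subset by auto
    qed
    \<comment> \<open>\<open>isCont\<close> speaks of punctured neighbourhoods; the point x itself
      can be added since \<open>h x\<close> is in W.\<close>
    have "\<forall>\<^sub>F t in nhds x. h t \<in> W"
      using cont W(1,2) tendsto_nhds_iff[of h "h x" x]
      by (auto simp: isCont_def intro: topological_tendstoD)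
    then obtain T where T: "open T" "x \<in> T" "\<And>t. t \<in> T \<Longrightarrow> h t \<in> W"
      unfolding eventually_nhds by blast
    from W(3) show False
    proof
      assume "W \<subseteq> A"
      then have "T \<subseteq> h -` A" using T(3) by auto
      then show False using x T(1,2) by (auto simp: frontier_def interior_def)
    next
      assume "W \<inter> A = {}"
      then have "T \<inter> h -` A = {}" using T(3) by auto
      then have "T \<inter> closure (h -` A) = {}" using T(1) by (simp add: open_Int_closure_eq_empty)
      then show False using x T(2) by (auto simp: frontier_def)
    qed
  qed
qed

context
  fixes m :: "nat \<Rightarrow> 'a::locally_convex_souslin_space measure" and m' :: "'a measure"
    and h :: "'a \<Rightarrow> real" and N :: "'a set"
  assumes prob: "\<And>n. prob_space (m n)" "prob_space m'"
    and borel: "\<And>n. sets (m n) = sets borel" "sets m' = sets borel"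
    and weak: "weakly_converges m m'"
    and h[measurable]: "\<And>n. h \<in> borel_measurable (completion (m n))"
      "h \<in> borel_measurable (completion m')"
    and discont: "{x. \<not> isCont h x} \<subseteq> N" "N \<in> null_sets (completion m')"
begin

lemma weakly_converges_bounded_ae_continuous:
  fixes f :: "real \<Rightarrow> real"
  assumes f: "\<And>t. isCont f t" "\<And>t. norm (f t) \<le> B"
  shows "(\<lambda>n. \<integral>x. f (h x) \<partial>completion (m n)) \<longlonglongrightarrow> (\<integral>x. f (h x) \<partial>completion m')"
proof -
  interpret n: prob_space "completion (m n)" for n
    using prob by (simp add: prob_space.prob_space_completion)
  interpret l: prob_space "completion m'"
    using prob by (simp add: prob_space.prob_space_completion)
  have sp[simp]: "space (m n) = UNIV" "space m' = UNIV" for n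
    using borel[THEN sets_eq_imp_space_eq] by auto
  let ?d = "\<lambda>n. distr (completion (m n)) borel h" and ?d' = "distr (completion m') borel h"
  have real: "real_distribution (?d n)" "real_distribution ?d'" for n
    by (simp_all add: real_distribution_def real_distribution_axioms_def n.prob_space_distr l.prob_space_distr)
  have "weak_conv_m ?d ?d'"
  proof (rule continuity_set_conv_imp_weak_conv[OF real])
    fix A :: "real set"
    assume A[measurable]: "A \<in> sets borel" and 0: "emeasure ?d' (frontier A) = 0"
    have "h -` frontier A \<in> null_sets (completion m')"
      using 0 measurable_sets[OF h(2), of "frontier A"]
      by (subst (asm) emeasure_distr) (auto simp: null_sets_def)
    then have null: "h -` frontier A \<union> N \<in> null_sets (completion m')"
      using discont by auto
    \<comment> \<open>The covering null set belongs only to the completion. A frontier is closed,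
      hence Borel, so nullity descends to \<open>m'\<close> itself.\<close>
    have "frontier (h -` A) \<in> sets m'" using borel by simp
    moreover have "frontier (h -` A) \<in> null_sets (completion m')"
      using frontier_vimage_subset[of h A] discont(1)
      by (intro null_sets_completion_subset[OF _ null]) auto
    ultimately have "frontier (h -` A) \<in> null_sets m'"
      by (simp add: null_sets_completion_iff)
    moreover have "h -` A \<in> sets (completion (m n))" "h -` A \<in> sets (completion m')" for n
      using measurable_sets[OF h(1) A] measurable_sets[OF h(2) A] by auto
    ultimately have "(\<lambda>n. measure (completion (m n)) (h -` A)) \<longlonglongrightarrow> measure (completion m') (h -` A)"
      by (intro weakly_converges_continuity_set prob borel weak) auto
    then show "(\<lambda>n. measure (?d n) A) \<longlonglongrightarrow> measure ?d' A"
      by (simp add: measure_distr)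
  qed
  from weak_conv_imp_integral_bdd_continuous_conv[OF real this f]
  have "(\<lambda>n. integral\<^sup>L (?d n) f) \<longlonglongrightarrow> integral\<^sup>L ?d' f" .
  moreover have [measurable]: "f \<in> borel_measurable borel"
    using f(1) by (intro borel_measurable_continuous_onI) (simp add: continuous_at_imp_continuous_on)
  ultimately show ?thesis by (simp add: integral_distr)
qed

text \<open>Cut h off at a level C. The truncated integrals converge by the bounded case; replacing
  h by its truncation costs at most e/3 under every \<open>m n\<close> by uniform integrability, and
  less than e/3 under \<open>m'\<close> by dominated convergence.\<close>

lemma weakly_converges_uniformly_integrable:
  assumes int: "integrable (completion m') h"
    and unif: "((\<lambda>C :: real. SUP n. \<integral>\<^sup>+x. ennreal \<bar>h x\<bar> * indicator {x. \<bar>h x\<bar> > C} x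
          \<partial>completion (m n)) \<longlongrightarrow> 0) at_top"
  shows "(\<lambda>n. \<integral>x. h x \<partial>completion (m n)) \<longlonglongrightarrow> (\<integral>x. h x \<partial>completion m')"
proof (rule tendstoI)
  interpret n: prob_space "completion (m n)" for n
    using prob by (simp add: prob_space.prob_space_completion)
  interpret l: prob_space "completion m'"
    using prob by (simp add: prob_space.prob_space_completion)
  \<comment> \<open>For C \<ge> 0 this clamps t to the interval from -C to C. It changes t only
    where |t| > C, and by at most |t|, which matches the tail in the hypothesis.\<close>
  define T where "T C t = max (- C) (min C t)" for C t :: real
  have T_bound: "norm (T C t) \<le> C" if "C \<ge> 0" for C t using that by (auto simp: T_def)
  have T_cont: "isCont (T C) t" for C t unfolding T_def by (intro continuous_intros)
  have [measurable]: "T C \<in> borel_measurable borel" for C unfolding T_def by measurable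
  have T_diff: "\<bar>t - T C t\<bar> \<le> \<bar>t\<bar> * indicator {t. \<bar>t\<bar> > C} t" if "C \<ge> 0" for C t
    using that by (auto simp: T_def indicator_def)
  fix e :: real assume "e > 0"
  have "((\<lambda>C. \<integral>x. T C (h x) \<partial>completion m') \<longlongrightarrow> (\<integral>x. h x \<partial>completion m')) at_top"
  proof (rule integral_dominated_convergence_at_top[where w="\<lambda>x. \<bar>h x\<bar>"])
    show "\<forall>\<^sub>F C in at_top. AE x in completion m'. norm (T C (h x)) \<le> \<bar>h x\<bar>"
      using eventually_ge_at_top[of 0] by eventually_elim (auto simp: T_def)
    show "AE x in completion m'. ((\<lambda>C. T C (h x)) \<longlongrightarrow> h x) at_top"
    proof (rule AE_I2)
      fix x
      have "\<forall>\<^sub>F C in at_top. T C (h x) = h x"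
        using eventually_ge_at_top[of "\<bar>h x\<bar>"] by eventually_elim (auto simp: T_def)
      then show "((\<lambda>C. T C (h x)) \<longlongrightarrow> h x) at_top" by (rule tendsto_eventually)
    qed
  qed (use int in auto)
  then have "\<forall>\<^sub>F C in at_top. dist (\<integral>x. T C (h x) \<partial>completion m') (\<integral>x. h x \<partial>completion m') < e / 3"
    using \<open>e > 0\<close> by (intro tendstoD) auto
  moreover have "\<forall>\<^sub>F C :: real in at_top. (SUP n. \<integral>\<^sup>+x. ennreal \<bar>h x\<bar> * indicator {x. \<bar>h x\<bar> > C} x
          \<partial>completion (m n)) < ennreal (e / 3)"
    using \<open>e > 0\<close> by (intro order_tendstoD(2)[OF unif]) (simp add: ennreal_zero_less_divide)
  \<comment> \<open>A single level C has to serve the limit measure and all \<open>m n\<close> at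
    once, so the eventual conditions are joined before C is chosen.\<close>
  ultimately have "\<forall>\<^sub>F C :: real in at_top. C \<ge> 0 \<and>
      dist (\<integral>x. T C (h x) \<partial>completion m') (\<integral>x. h x \<partial>completion m') < e / 3 \<and>
      (SUP n. \<integral>\<^sup>+x. ennreal \<bar>h x\<bar> * indicator {x. \<bar>h x\<bar> > C} x \<partial>completion (m n)) < ennreal (e / 3)"
    using eventually_ge_at_top[of 0] by eventually_elim simp
  then obtain C where C: "C \<ge> 0"
      "dist (\<integral>x. T C (h x) \<partial>completion m') (\<integral>x. h x \<partial>completion m') < e / 3"
      "(SUP n. \<integral>\<^sup>+x. ennreal \<bar>h x\<bar> * indicator {x. \<bar>h x\<bar> > C} x \<partial>completion (m n)) < ennreal (e / 3)"
    using eventually_happens'[OF trivial_limit_at_top_linorder] by blast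
  have tail: "(\<integral>\<^sup>+x. norm (h x - T C (h x)) \<partial>completion (m n)) < ennreal (e / 3)" for n
  proof -
    have "(\<integral>\<^sup>+x. norm (h x - T C (h x)) \<partial>completion (m n)) \<le>
        (\<integral>\<^sup>+x. ennreal \<bar>h x\<bar> * indicator {x. \<bar>h x\<bar> > C} x \<partial>completion (m n))"
    proof (rule nn_integral_mono)
      fix x
      show "ennreal (norm (h x - T C (h x))) \<le> ennreal \<bar>h x\<bar> * indicator {x. \<bar>h x\<bar> > C} x"
        using T_diff[OF C(1), of "h x"] by (auto simp: indicator_def intro: ennreal_leI)
    qed
    also have "\<dots> \<le> (SUP n. \<integral>\<^sup>+x. ennreal \<bar>h x\<bar> * indicator {x. \<bar>h x\<bar> > C} x \<partial>completion (m n))"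
      by (rule SUP_upper) simp
    finally show ?thesis using C(3) by (rule le_less_trans)
  qed
  have T_int: "integrable (completion (m n)) (\<lambda>x. T C (h x))" for n
    using T_bound[OF C(1)] by (intro n.integrable_const_bound[where B=C]) auto
  have diff_int: "integrable (completion (m n)) (\<lambda>x. h x - T C (h x))" for n
    using tail[of n] by (intro integrableI_bounded) (auto intro: less_trans)
  have close: "dist (\<integral>x. h x \<partial>completion (m n)) (\<integral>x. T C (h x) \<partial>completion (m n)) \<le> e / 3" for n
  proof -
    \<comment> \<open>h is its bounded truncation plus a remainder whose integral is finite by the
      tail bound.\<close>
    have h_int: "integrable (completion (m n)) h"
      using Bochner_Integration.integrable_add[OF diff_int T_int] by simp
    have "ennreal (norm (\<integral>x. h x - T C (h x) \<partial>completion (m n))) \<le> ennreal (e / 3)"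
      using integral_norm_bound_ennreal[OF diff_int] tail by (meson less_imp_le order_trans)
    then show ?thesis using \<open>e > 0\<close> h_int T_int
      by (simp add: dist_norm Bochner_Integration.integral_diff)
  qed
  have "(\<lambda>n. \<integral>x. T C (h x) \<partial>completion (m n)) \<longlonglongrightarrow> (\<integral>x. T C (h x) \<partial>completion m')"
    by (rule weakly_converges_bounded_ae_continuous[OF T_cont T_bound[OF C(1)]])
  then have "\<forall>\<^sub>F n in sequentially.
      dist (\<integral>x. T C (h x) \<partial>completion (m n)) (\<integral>x. T C (h x) \<partial>completion m') < e / 3"
    using \<open>e > 0\<close> by (intro tendstoD) auto
  then show "\<forall>\<^sub>F n in sequentially. dist (\<integral>x. h x \<partial>completion (m n)) (\<integral>x. h x \<partial>completion m') < e"
  proof eventually_elim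
    case (elim n)
    then show ?case using C(2) close[of n] unfolding dist_real_def by linarith
  qed
qed

end

section \<open>Posterior integrals as quotients\<close>

text \<open>Turns the two bounds defining \<open>M0\<close> into a nonzero real normalising
  constant.\<close>

lemma nn_integral_eq_integral_pos:
  fixes g :: "'a \<Rightarrow> real"
  assumes "g \<in> borel_measurable M" "\<And>x. 0 \<le> g x"
    and "0 < (\<integral>\<^sup>+x. ennreal (g x) \<partial>M)" "(\<integral>\<^sup>+x. ennreal (g x) \<partial>M) < \<infinity>"
  shows "(\<integral>\<^sup>+x. ennreal (g x) \<partial>M) = ennreal (\<integral>x. g x \<partial>M)" and "0 < (\<integral>x. g x \<partial>M)"
proof -
  have "integrable M g" using assms by (intro integrableI_nonneg) auto
  then show *: "(\<integral>\<^sup>+x. ennreal (g x) \<partial>M) = ennreal (\<integral>x. g x \<partial>M)"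
    using assms(2) by (intro nn_integral_eq_integral) auto
  show "0 < (\<integral>x. g x \<partial>M)" using assms(3) unfolding * by simp
qed

text \<open>With c the normalising constant, the posterior is the measure with density \<rho>/c over
  the completion, restricted to the \<sigma>-algebra of m. The restriction is written as the image
  under the identity map, so that change of variables applies.\<close>

lemma integral_posterior:
  fixes f :: "'a \<Rightarrow> real"
  assumes \<rho>[measurable]: "(\<lambda>x. \<rho> x y) \<in> borel_measurable (completion m)"
    and nonneg: "\<And>x. 0 \<le> \<rho> x y"
    and norm: "0 < (\<integral>\<^sup>+x. ennreal (\<rho> x y) \<partial>completion m)" "(\<integral>\<^sup>+x. ennreal (\<rho> x y) \<partial>completion m) < \<infinity>"
    and f[measurable]: "f \<in> borel_measurable m"
  shows "integral\<^sup>L (posterior m \<rho> y) f =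
    (\<integral>x. f x * \<rho> x y \<partial>completion m) / (\<integral>x. \<rho> x y \<partial>completion m)"
proof -
  define c where "c = (\<integral>x. \<rho> x y \<partial>completion m)"
  have nn: "(\<integral>\<^sup>+x. ennreal (\<rho> x y) \<partial>completion m) = ennreal c" and c: "0 < c"
    unfolding c_def by (rule nn_integral_eq_integral_pos[OF \<rho> nonneg norm])+
  have id[measurable]: "(\<lambda>x. x) \<in> measurable (completion m) m"
    by (rule measurable_completion) simp
  let ?d = "density (completion m) (\<lambda>x. ennreal (\<rho> x y / c))"
  have [measurable]: "(\<lambda>x. x) \<in> measurable ?d m" by simp
  have "posterior m \<rho> y = distr ?d m (\<lambda>x. x)"
  proof (rule measure_eqI)
    show "sets (posterior m \<rho> y) = sets (distr ?d m (\<lambda>x. x))"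
      by (simp add: posterior_def)
    fix U assume "U \<in> sets (posterior m \<rho> y)"
    then have U: "U \<in> sets m" by (simp add: posterior_def)
    then have [measurable]: "U \<in> sets (completion m)" by simp
    have "emeasure (distr ?d m (\<lambda>x. x)) U = emeasure ?d U"
      using U by (subst emeasure_distr) (auto simp: sets.Int_space_eq2 dest: sets.sets_into_space intro!: arg_cong[where f="emeasure ?d"])
    \<comment> \<open>Nonnegativity of \<rho> and c > 0 let \<open>ennreal\<close> commute with the
      division.\<close>
    also have "\<dots> = (\<integral>\<^sup>+x. indicator U x * ennreal (\<rho> x y) / ennreal c \<partial>completion m)"
      using c nonneg by (subst emeasure_density)
        (auto simp: divide_ennreal[symmetric] divide_ennreal_def mult_ac intro!: nn_integral_cong)
    also have "\<dots> = (\<integral>\<^sup>+x. indicator U x * ennreal (\<rho> x y) \<partial>completion m) / ennreal c"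
      by (rule nn_integral_divide) measurable
    also have "\<dots> = emeasure (posterior m \<rho> y) U"
      using emeasure_posterior[where \<rho>=\<rho> and y=y, OF \<rho> U] nn by simp
    finally show "emeasure (posterior m \<rho> y) U = emeasure (distr ?d m (\<lambda>x. x)) U" ..
  qed
  then have "integral\<^sup>L (posterior m \<rho> y) f = integral\<^sup>L ?d f"
    by (simp add: integral_distr)
  also have "\<dots> = (\<integral>x. \<rho> x y / c * f x \<partial>completion m)"
    using nonneg c by (subst integral_real_density) (auto intro: measurable_completion)
  \<comment> \<open>If the integrand is not integrable, both integrals take the default value 0 and
    the equation persists.\<close>
  also have "\<dots> = (\<integral>x. f x * \<rho> x y \<partial>completion m) / c"
    by (simp add: mult.commute flip: Bochner_Integration.integral_divide_zero)
  finally show "integral\<^sup>L (posterior m \<rho> y) f =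
    (\<integral>x. f x * \<rho> x y \<partial>completion m) / (\<integral>x. \<rho> x y \<partial>completion m)" by (simp add: c_def)
qed

section \<open>Convergence of the conditional means\<close>

theorem theorem4p5:
  fixes P :: "'w measure"
    and X :: "'w \<Rightarrow> 'f::locally_convex_souslin_space"
    and Xn :: "nat \<Rightarrow> 'w \<Rightarrow> 'f"
    and \<epsilon> :: "'w \<Rightarrow> 'g::locally_convex_souslin_space"
    and L :: "'f \<Rightarrow> 'g"
    and Y :: "'w \<Rightarrow> 'g"
    and Yn :: "nat \<Rightarrow> 'w \<Rightarrow> 'g"
    and \<nu> :: "'g measure"
    and \<rho> :: "'f \<Rightarrow> 'g \<Rightarrow> real"
    and y :: 'g
  assumes model: "bayes_model P X Xn \<epsilon> L Y Yn \<nu> \<rho>"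
    and y: "y \<in> M0 P X Xn \<rho>"
    and discont: "\<exists>N \<in> null_sets (completion (distr P borel X)).
      {x. \<not> isCont (\<lambda>x. \<rho> x y) x} \<subseteq> N"
    and L1: "\<And>\<alpha> k. \<alpha> \<in> topological_dual \<Longrightarrow> k \<in> {0, 1 :: nat} \<Longrightarrow>
      integrable (completion (distr P borel X)) (\<lambda>x. \<alpha> x ^ k * \<rho> x y)"
    and unif: "\<And>\<alpha> k. \<alpha> \<in> topological_dual \<Longrightarrow> k \<in> {0, 1 :: nat} \<Longrightarrow>
      ((\<lambda>C :: real. SUP n. \<integral>\<^sup>+x. ennreal (\<bar>\<alpha> x\<bar> ^ k * \<rho> x y) *
            indicator {x. \<bar>\<alpha> x\<bar> ^ k * \<rho> x y > C} x \<partial>completion (distr P borel (Xn n)))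
        \<longlongrightarrow> 0) at_top"
    and weak: "weakly_converges (\<lambda>n. distr P borel (Xn n)) (distr P borel X)"
  shows "\<forall>\<alpha> \<in> topological_dual.
    (\<lambda>n. integral\<^sup>L (posterior (distr P borel (Xn n)) \<rho> y) \<alpha>)
      \<longlonglongrightarrow> integral\<^sup>L (posterior (distr P borel X) \<rho> y) \<alpha>"
proof
  interpret bayes_model P X Xn \<epsilon> L Y Yn \<nu> \<rho> by (fact model)
  fix \<alpha> :: "'f \<Rightarrow> real" assume \<alpha>: "\<alpha> \<in> topological_dual"
  let ?m = "\<lambda>n. distr P borel (Xn n)" and ?m' = "distr P borel X"
  have \<alpha>_cont: "continuous_on UNIV \<alpha>" using \<alpha> by (simp add: topological_dual_def)
  then have \<alpha>_borel: "\<alpha> \<in> borel_measurable borel" by (rule borel_measurable_continuous_onI)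
  have prob: "prob_space (?m n)" "prob_space ?m'" for n
    using Xn_measurable X_measurable by (auto intro: prob_space_distr)
  have nonneg: "0 \<le> \<rho> x y" for x using density_\<rho> by (simp add: has_density_def)
  have meas: "(\<lambda>x. \<rho> x y) \<in> borel_measurable (completion (?m n))"
      "(\<lambda>x. \<rho> x y) \<in> borel_measurable (completion ?m')"
    and mass: "0 < (\<integral>\<^sup>+x. ennreal (\<rho> x y) \<partial>completion (?m n))"
      "(\<integral>\<^sup>+x. ennreal (\<rho> x y) \<partial>completion (?m n)) < \<infinity>"
      "0 < (\<integral>\<^sup>+x. ennreal (\<rho> x y) \<partial>completion ?m')"
      "(\<integral>\<^sup>+x. ennreal (\<rho> x y) \<partial>completion ?m') < \<infinity>" for n
    using y by (auto simp: M0_def)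
  obtain N where N: "N \<in> null_sets (completion ?m')" "{x. \<not> isCont (\<lambda>x. \<rho> x y) x} \<subseteq> N"
    using discont by blast
  \<comment> \<open>The case k = 0 yields the denominators and k = 1 the numerators of the posterior
    means.\<close>
  have moment: "(\<lambda>n. \<integral>x. \<alpha> x ^ k * \<rho> x y \<partial>completion (?m n)) \<longlonglongrightarrow>
      (\<integral>x. \<alpha> x ^ k * \<rho> x y \<partial>completion ?m')" if k: "k \<in> {0, 1}" for k
  proof (rule weakly_converges_uniformly_integrable[OF prob _ _ weak])
    show "(\<lambda>x. \<alpha> x ^ k * \<rho> x y) \<in> borel_measurable (completion (?m n))"
      "(\<lambda>x. \<alpha> x ^ k * \<rho> x y) \<in> borel_measurable (completion ?m')" for n
      using \<alpha>_borel
      by (auto intro!: borel_measurable_times borel_measurable_power meas intro: measurable_completion)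
    \<comment> \<open>Multiplying by the continuous factor \<alpha>^k creates no new
      discontinuities, so the same null set N works for both k.\<close>
    have "isCont \<alpha> x" for x using \<alpha>_cont by (simp add: continuous_on_eq_continuous_at)
    then have "isCont (\<lambda>x. \<alpha> x ^ k * \<rho> x y) x" if "isCont (\<lambda>x. \<rho> x y) x" for x
      using that by (intro continuous_intros)
    then show "{x. \<not> isCont (\<lambda>x. \<alpha> x ^ k * \<rho> x y) x} \<subseteq> N" using N(2) by blast
    show "N \<in> null_sets (completion ?m')" by (fact N(1))
    show "integrable (completion ?m') (\<lambda>x. \<alpha> x ^ k * \<rho> x y)" by (rule L1[OF \<alpha> k])
    \<comment> \<open>Since \<rho> is nonnegative, |\<alpha>|^k \<rho> is the absolute value of
      \<alpha>^k \<rho>.\<close>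
    show "((\<lambda>C :: real. SUP n. \<integral>\<^sup>+x. ennreal \<bar>\<alpha> x ^ k * \<rho> x y\<bar> *
        indicator {x. \<bar>\<alpha> x ^ k * \<rho> x y\<bar> > C} x \<partial>completion (?m n)) \<longlongrightarrow> 0) at_top"
      using unif[OF \<alpha> k] by (simp only: abs_mult power_abs abs_of_nonneg[OF nonneg])
  qed simp_all
  \<comment> \<open>The quotient may pass to the limit because y in \<open>M0\<close> makes the
    limit denominator strictly positive.\<close>
  have "(\<lambda>n. (\<integral>x. \<alpha> x * \<rho> x y \<partial>completion (?m n)) / (\<integral>x. \<rho> x y \<partial>completion (?m n))) \<longlonglongrightarrow>
      (\<integral>x. \<alpha> x * \<rho> x y \<partial>completion ?m') / (\<integral>x. \<rho> x y \<partial>completion ?m')"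
    using moment[of 0] moment[of 1] nn_integral_eq_integral_pos(2)[OF meas(2) nonneg mass(3,4)]
    by (intro tendsto_divide) auto
  then show "(\<lambda>n. integral\<^sup>L (posterior (?m n) \<rho> y) \<alpha>) \<longlonglongrightarrow> integral\<^sup>L (posterior ?m' \<rho> y) \<alpha>"
    using \<alpha>_borel
    by (simp add: integral_posterior[where \<rho>=\<rho> and y=y, OF meas(1) nonneg mass(1,2)]
      integral_posterior[where \<rho>=\<rho> and y=y, OF meas(2) nonneg mass(3,4)])
qed

end
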